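(* Let $K$ be a field, $n\ge1$, $D=K[X_1,\ldots,X_n]$, $F=K(X_1,\ldots,X_n)$, and let $R^*=\sigma(R(D))$, where $\sigma:F\to F$ is the $K$-automorphism with $\sigma(X_i)=1/X_i$ for $1\le i\le n$. Then $R^*\subseteq D_{(X_i)}$ for each $1\le i\le n$. In particular, there are $n$ distinct height one prime ideals $\mathfrak p_1,\ldots,\mathfrak p_n$ of $R^*$, where $\mathfrak p_i$ is the center on $R^*$ of the $X_i$-adic valuation of $D$, and $R^*_{\mathfrak p_i}=D_{(X_i)}$ for each $i$.
   Context: For an integral domain $T$, the reciprocal complement $R(T)$ is the subring of the fraction field of $T$ generated by all $1/f$ with $f\in T\setminus\{0\}$. $D_{(X_i)}$ denotes the localization of $D$ at the prime ideal $X_iD$; it is the valuation ring of the $X_i$-adic valuation on $F$. The center on a subring $A$ of a valuation ring $V\supseteq A$ with maximal ideal $\mathfrak m_V$ is the prime ideal $\mathfrak m_V\cap A$. *)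

theory Defs
  imports
    "HOL-Library.Poly_Mapping"
    "HOL-Library.Extended_Nat"
    "HOL-Computational_Algebra.Polynomial_Factorial"
    "HOL-Algebra.Generated_Rings"
    "HOL-Algebra.QuotRing"
    "HOL-Algebra.Algebraic_Closure_Type"
begin

section \<open>Subrings of a field\<close>

text \<open>Every ring below is a subset of a field given as a type. To apply the ideal theory of
  HOL-Algebra to such a subset, the latter is regarded as the carrier of a ring record
  with the operations of the ambient field.\<close>

abbreviation subring_of_type :: "'f::field set \<Rightarrow> 'f ring" where
  "subring_of_type A \<equiv> ring_of_type_algebra\<lparr>carrier := A\<rparr>"

text \<open>Supremum of the lengths \<open>k\<close> of the chains of primes \<open>c 0 \<subset> \<dots> \<subset> c k = P\<close>.\<close>

definition prime_height :: "('a, 'b) ring_scheme \<Rightarrow> 'a set \<Rightarrow> enat" where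
  "prime_height R P =
    Sup {enat k |k. \<exists>c :: nat \<Rightarrow> 'a set.
      (\<forall>j\<le>k. primeideal (c j) R) \<and> (\<forall>j<k. c j \<subset> c (Suc j)) \<and> c k = P}"

text \<open>The localization \<open>A\<^sub>P\<close>, as a subset of the ambient field.\<close>

definition localization :: "'f::field set \<Rightarrow> 'f set \<Rightarrow> 'f set" where
  "localization A P = {a / s |a s. a \<in> A \<and> s \<in> A - P}"

text \<open>The center on \<open>A\<close> of a valuation ring \<open>V\<close> containing \<open>A\<close>; a valuation ring has
  exactly one maximal ideal, so the description is proper.\<close>

definition center :: "'f::field set \<Rightarrow> 'f set \<Rightarrow> 'f set" where
  "center V A = (THE M. maximalideal M (subring_of_type V)) \<inter> A"

section \<open>Integral domains and their fraction fields\<close>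

text \<open>The domain \<open>T\<close> is the type \<open>'a\<close>.\<close>

definition reciprocal_complement :: "'a::idom fract set" where
  "reciprocal_complement =
    generate_ring ring_of_type_algebra {1 / to_fract f |f. f \<noteq> 0}"

text \<open>For a prime element \<open>a\<close> of a factorial domain: \<open>adic_order a f\<close> is the exponent of \<open>a\<close>
  in \<open>f \<noteq> 0\<close>, and \<open>adic_valuation a\<close> is the \<open>a\<close>-adic valuation on the nonzero fractions,
  where the difference of exponents does not depend on the chosen representation.
  The value \<open>\<infinity>\<close> at \<open>0\<close> is not represented, so that \<open>0\<close> is treated separately in the
  valuation ring.\<close>

definition adic_order :: "'a::idom \<Rightarrow> 'a \<Rightarrow> nat" where
  "adic_order a f = (GREATEST k. a ^ k dvd f)"

definition adic_valuation :: "'a::idom \<Rightarrow> 'a fract \<Rightarrow> int" where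
  "adic_valuation a x =
    (THE z. \<exists>f g. f \<noteq> 0 \<and> g \<noteq> 0 \<and> x = Fract f g \<and> z = int (adic_order a f) - int (adic_order a g))"

definition valuation_ring :: "('f::field \<Rightarrow> int) \<Rightarrow> 'f set" where
  "valuation_ring v = {x. x = 0 \<or> 0 \<le> v x}"

section \<open>Polynomials and rational functions in finitely many variables\<close>

text \<open>\<open>('n, 'k) mpoly\<close> is the polynomial ring over \<open>'k\<close> in the variables indexed by the finite
  nonempty type \<open>'n\<close>, represented by the coefficients of the monomials. The library's
  instance making it an integral domain asks for a linear order on \<open>'n\<close>; like the order of the
  indices \<open>1, \<dots>, n\<close>, it is no restriction.\<close>

type_synonym ('n, 'k) mpoly = "('n \<Rightarrow>\<^sub>0 nat) \<Rightarrow>\<^sub>0 'k"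

definition const_poly :: "'k \<Rightarrow> ('n, 'k::field) mpoly" where
  "const_poly c = Poly_Mapping.single 0 c"

definition var_poly :: "'n \<Rightarrow> ('n, 'k::field) mpoly" where
  "var_poly i = Poly_Mapping.single (Poly_Mapping.single i 1) 1"

text \<open>The constants, the variables and the polynomials inside the field of rational functions.\<close>

definition ratC :: "'k \<Rightarrow> ('n::{finite,linorder}, 'k::field) mpoly fract" where
  "ratC c = to_fract (const_poly c)"

definition ratX :: "'n \<Rightarrow> ('n::{finite,linorder}, 'k::field) mpoly fract" where
  "ratX i = to_fract (var_poly i)"

definition polyD :: "('n::{finite,linorder}, 'k::field) mpoly fract set" where
  "polyD = range to_fract"

text \<open>\<open>D\<close> localized at the prime ideal \<open>X\<^sub>iD\<close>\<close>

definition locD :: "'n \<Rightarrow> ('n::{finite,linorder}, 'k::field) mpoly fract set" where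
  "locD i = localization polyD (PIdl\<^bsub>subring_of_type polyD\<^esub> (ratX i))"

end

theory Submission
  imports Defs
begin

text \<open>The automorphism turns a polynomial \<open>f\<close> into a Laurent polynomial. Multiplying the latter by
  the monomial \<open>X\<^sup>N\<close>, where \<open>N\<close> collects the degrees of \<open>f\<close> in the single variables, clears the
  negative exponents and gives the reversed polynomial \<open>g\<close>. In \<open>g\<close>, the terms of \<open>f\<close> of maximal
  degree in \<open>X\<^sub>i\<close> have become free of \<open>X\<^sub>i\<close>, so that no variable divides \<open>g\<close>. Hence the image
  \<open>X\<^sup>N / g\<close> of \<open>1 / f\<close> has a denominator prime to \<open>X\<^sub>i\<close>; this is \<open>hom_polynomial\<close>, and it puts \<open>R\<^sup>*\<close>
  into the localization of \<open>D\<close> at \<open>X\<^sub>i\<close>, for every \<open>i\<close> at once.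

  In the other direction, \<open>R\<^sup>*\<close> contains \<open>D\<close>: the constants are reciprocals of constants, and a
  monomial is the image of its own reciprocal. The rest holds for every ring \<open>A\<close> between a domain
  and its localization \<open>V\<close> at a prime element \<open>p\<close> of which every nonzero element has finite order.
  Such a \<open>V\<close> is a valuation ring whose maximal ideal \<open>M\<close> consists of the multiples of \<open>p\<close>.
  Elements of the domain prime to \<open>p\<close> lie in \<open>A\<close> but not in the center \<open>M \<inter> A\<close>, so that
  localizing \<open>A\<close> at the center gives all denominators of \<open>V\<close>. A nonzero prime of \<open>A\<close> inside
  the center contains some power of \<open>p\<close> times an element outside the center, hence \<open>p\<close> itself,
  hence the whole center (\<open>nonzero_prime_below_center\<close>); so the center has height one.
  Finally, \<open>X\<^sub>i\<close> lies in the center of its own valuation only, which makes the centers distinct.\<close>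

section \<open>Ideals of a subring of a field\<close>

lemma subring_of_typeI:
  fixes A :: "'f::field set"
  assumes "1 \<in> A" "\<And>x. x \<in> A \<Longrightarrow> - x \<in> A"
    "\<And>x y. x \<in> A \<Longrightarrow> y \<in> A \<Longrightarrow> x * y \<in> A" "\<And>x y. x \<in> A \<Longrightarrow> y \<in> A \<Longrightarrow> x + y \<in> A"
  shows "subring A ring_of_type_algebra"
proof -
  interpret R: ring "ring_of_type_algebra :: 'f ring" by rule
  have neg: "\<ominus>\<^bsub>ring_of_type_algebra\<^esub> x = - x" for x :: 'f
    by (rule R.minus_equality) (auto simp: ring_of_type_algebra_def)
  show ?thesis
    by (rule R.subringI) (use assms in \<open>auto simp: neg\<close>, auto simp: ring_of_type_algebra_def assms)
qed

lemma subring_of_typeD: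
  fixes A :: "'f::field set"
  assumes "subring A ring_of_type_algebra"
  shows "0 \<in> A" "1 \<in> A" "x \<in> A \<Longrightarrow> - x \<in> A"
    "x \<in> A \<Longrightarrow> y \<in> A \<Longrightarrow> x * y \<in> A" "x \<in> A \<Longrightarrow> y \<in> A \<Longrightarrow> x + y \<in> A"
proof -
  interpret R: ring "ring_of_type_algebra :: 'f ring" by rule
  have neg: "\<ominus>\<^bsub>ring_of_type_algebra\<^esub> x = - x" for x :: 'f
    by (rule R.minus_equality) (auto simp: ring_of_type_algebra_def)
  show "0 \<in> A" "1 \<in> A" "x \<in> A \<Longrightarrow> - x \<in> A"
    "x \<in> A \<Longrightarrow> y \<in> A \<Longrightarrow> x * y \<in> A" "x \<in> A \<Longrightarrow> y \<in> A \<Longrightarrow> x + y \<in> A"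
    using subringE(2,3,5,6,7)[OF assms] by (auto simp: neg) (auto simp: ring_of_type_algebra_def)
qed

lemma cring_subring_of_type:
  fixes A :: "'f::field set"
  assumes "subring A ring_of_type_algebra"
  shows "cring (subring_of_type A)"
proof -
  interpret R: cring "ring_of_type_algebra :: 'f ring" by rule
  show ?thesis
    using R.subcringI'[OF assms] R.subcring_iff[of A] by (auto simp: ring_of_type_algebra_def)
qed

lemma ideal_subring_of_type_iff:
  fixes A :: "'f::field set"
  assumes A: "subring A ring_of_type_algebra"
  shows "ideal I (subring_of_type A) \<longleftrightarrow>
    I \<subseteq> A \<and> 0 \<in> I \<and> (\<forall>x\<in>I. \<forall>y\<in>I. x + y \<in> I) \<and> (\<forall>a\<in>A. \<forall>x\<in>I. a * x \<in> I)"
    (is "?l \<longleftrightarrow> ?r")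
proof
  interpret cring "subring_of_type A" by (rule cring_subring_of_type[OF A])
  {
    assume ?l
    then interpret ideal I "subring_of_type A" .
    show ?r
      using a_subset a_closed zero_closed I_l_closed by (auto simp: ring_of_type_algebra_def)
  next
    assume r: ?r
    have neg: "- x \<in> I" if "x \<in> I" for x
      using r that subring_of_typeD(2,3)[OF A] mult_minus1[of x] by (metis (no_types))
    have sub: "subgroup I (add_monoid (subring_of_type A))"
    proof (rule add.subgroupI)
      fix x assume x: "x \<in> I"
      have "\<ominus>\<^bsub>subring_of_type A\<^esub> x = - x"
        by (rule minus_equality) (use x neg r in \<open>auto simp: ring_of_type_algebra_def\<close>)
      with x neg show "\<ominus>\<^bsub>subring_of_type A\<^esub> x \<in> I" by simp
    qed (use r in \<open>auto simp: ring_of_type_algebra_def\<close>)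
    show ?l
      by (rule idealI[OF ring_axioms sub])
        (use r in \<open>simp_all add: ring_of_type_algebra_def\<close>, metis mult.commute)
  }
qed

lemma primeideal_subring_of_type_iff:
  fixes A :: "'f::field set"
  assumes A: "subring A ring_of_type_algebra"
  shows "primeideal P (subring_of_type A) \<longleftrightarrow>
    ideal P (subring_of_type A) \<and> 1 \<notin> P \<and> (\<forall>a\<in>A. \<forall>b\<in>A. a * b \<in> P \<longrightarrow> a \<in> P \<or> b \<in> P)"
    (is "?l \<longleftrightarrow> ?r")
proof
  assume ?l
  then interpret primeideal P "subring_of_type A" .
  show ?r
    using is_ideal I_notcarr I_prime one_imp_carrier by (auto simp: ring_of_type_algebra_def)
next
  assume r: ?r
  then show ?l
    using subring_of_typeD(2)[OF A]
    by (intro primeidealI[OF _ cring_subring_of_type[OF A]]) (auto simp: ring_of_type_algebra_def)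
qed

lemma maximalideal_subring_of_type_iff:
  fixes A :: "'f::field set"
  assumes A: "subring A ring_of_type_algebra"
  shows "maximalideal M (subring_of_type A) \<longleftrightarrow>
    ideal M (subring_of_type A) \<and> 1 \<notin> M \<and>
    (\<forall>J. ideal J (subring_of_type A) \<and> M \<subseteq> J \<and> 1 \<notin> J \<longrightarrow> J = M)"
    (is "?l \<longleftrightarrow> ?r")
proof
  assume ?l
  then interpret maximalideal M "subring_of_type A" .
  have "J = M" if J: "ideal J (subring_of_type A)" "M \<subseteq> J" "1 \<notin> J" for J
  proof -
    have "J \<subseteq> A" using J(1) by (simp add: ideal_subring_of_type_iff[OF A])
    then show ?thesis using I_maximal[OF J(1,2)] J(3) subring_of_typeD(2)[OF A] by auto
  qed
  then show ?r
    using is_ideal I_notcarr one_imp_carrier by (auto simp: ring_of_type_algebra_def)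
next
  assume r: ?r
  have one: "J = A" if "ideal J (subring_of_type A)" "1 \<in> J" for J
    using that ideal.one_imp_carrier[OF that(1)] by (auto simp: ring_of_type_algebra_def)
  show ?l
    by (rule maximalidealI) (use r one subring_of_typeD(2)[OF A] in \<open>auto\<close>)
qed

section \<open>The valuation ring of a prime element\<close>

text \<open>For a prime element \<open>p\<close>, this is the localization at the ideal generated by \<open>p\<close>. Fractions
  need not be reduced: membership only asks for one suitable representation.\<close>

definition local_ring :: "'a::idom \<Rightarrow> 'a fract set" where
  "local_ring p = {to_fract f / to_fract g |f g. \<not> p dvd g}"

definition local_max :: "'a::idom \<Rightarrow> 'a fract set" where
  "local_max p = {to_fract f / to_fract g |f g. p dvd f \<and> \<not> p dvd g}"

text \<open>Finite orders replace unique factorization: all that is used of a factorial domain is the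
  decomposition of an element into a power of one fixed prime and a cofactor prime to it.\<close>

locale finite_order_prime =
  fixes p :: "'a::idom"
  assumes prime: "prime_elem p"
    and finite_order: "f \<noteq> 0 \<Longrightarrow> \<exists>k. \<not> p ^ k dvd f"
begin

lemma p_nonzero: "p \<noteq> 0"
  using prime by (rule prime_elem_not_zeroI)

lemma not_dvd_one: "\<not> p dvd 1"
  using prime by (simp add: prime_elem_def)

lemma prime_factorization:
  assumes "f \<noteq> 0"
  obtains k g where "f = p ^ k * g" "\<not> p dvd g"
proof -
  define k where "k = (LEAST k. \<not> p ^ k dvd f)"
  have k: "\<not> p ^ k dvd f"
    unfolding k_def using finite_order[OF assms] by (rule LeastI_ex)
  then obtain j where j: "k = Suc j"
    by (cases k) auto
  have "p ^ j dvd f"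
    using not_less_Least[of j "\<lambda>k. \<not> p ^ k dvd f"] j unfolding k_def by auto
  then obtain g where g: "f = p ^ j * g" ..
  have "\<not> p dvd g"
    using k g j p_nonzero by (auto simp: mult.commute)
  with g show ?thesis using that by blast
qed

lemma adic_order_eq:
  assumes "\<not> p dvd g"
  shows "adic_order p (p ^ k * g) = k"
  unfolding adic_order_def
proof (rule Greatest_equality)
  fix j assume j: "p ^ j dvd p ^ k * g"
  show "j \<le> k"
  proof (rule ccontr)
    assume "\<not> j \<le> k"
    then have "p ^ Suc k dvd p ^ k * g"
      using j le_imp_power_dvd[of "Suc k" j p] dvd_trans by fastforce
    then show False
      using assms p_nonzero by (simp add: mult.commute)
  qed
qed simp

text \<open>Primality of \<open>p\<close> enters here: the product of two cofactors prime to \<open>p\<close> is prime to \<open>p\<close>.\<close>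

lemma adic_order_mult:
  assumes "f \<noteq> 0" "g \<noteq> 0"
  shows "adic_order p (f * g) = adic_order p f + adic_order p g"
proof -
  obtain k a where a: "f = p ^ k * a" "\<not> p dvd a" using prime_factorization[OF assms(1)] .
  obtain l b where b: "g = p ^ l * b" "\<not> p dvd b" using prime_factorization[OF assms(2)] .
  have "f * g = p ^ (k + l) * (a * b)" by (simp add: a b power_add ac_simps)
  moreover have "\<not> p dvd a * b" using a b prime by (simp add: prime_elem_dvd_mult_iff)
  ultimately show ?thesis using a b adic_order_eq by metis
qed

text \<open>Additivity of the order makes the difference independent of the representing fraction.\<close>

lemma adic_valuation_Fract:
  assumes "f \<noteq> 0" "g \<noteq> 0"
  shows "adic_valuation p (Fract f g) = int (adic_order p f) - int (adic_order p g)"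
  unfolding adic_valuation_def
proof (rule the_equality)
  fix z assume "\<exists>f' g'. f' \<noteq> 0 \<and> g' \<noteq> 0 \<and> Fract f g = Fract f' g' \<and>
    z = int (adic_order p f') - int (adic_order p g')"
  then obtain f' g' where h: "f' \<noteq> 0" "g' \<noteq> 0" "Fract f g = Fract f' g'"
    "z = int (adic_order p f') - int (adic_order p g')" by blast
  have "f * g' = f' * g" using h assms by (simp add: eq_fract)
  then have "adic_order p f + adic_order p g' = adic_order p f' + adic_order p g"
    using adic_order_mult assms h(1,2) by metis
  with h(4) show "z = int (adic_order p f) - int (adic_order p g)" by linarith
qed (use assms in blast)

text \<open>A nonnegative difference of orders allows to cancel the power of \<open>p\<close> in the denominator.\<close>

lemma valuation_ring_eq: "valuation_ring (adic_valuation p) = local_ring p"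
proof (intro equalityI subsetI)
  fix x assume x: "x \<in> valuation_ring (adic_valuation p)"
  show "x \<in> local_ring p"
  proof (cases "x = 0")
    case True
    then show ?thesis
      using not_dvd_one unfolding local_ring_def by (intro CollectI exI[of _ 0] exI[of _ 1]) simp
  next
    case False
    obtain f g where fg: "x = Fract f g" "g \<noteq> 0" by (cases x) auto
    have f: "f \<noteq> 0" using False fg by (auto simp: fract_collapse)
    obtain k a where a: "f = p ^ k * a" "\<not> p dvd a" using prime_factorization[OF f] .
    obtain l b where b: "g = p ^ l * b" "\<not> p dvd b" using prime_factorization[OF fg(2)] .
    have "adic_valuation p x = int k - int l"
      using adic_valuation_Fract[OF f fg(2)] fg a b by (simp add: adic_order_eq)
    then have "l \<le> k" using x False by (auto simp: valuation_ring_def)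
    then have "f * b = p ^ (k - l) * a * g"
      by (simp add: a b power_add[symmetric] ac_simps)
    moreover have "b \<noteq> 0" using b by auto
    ultimately have "x = Fract (p ^ (k - l) * a) b"
      using fg by (simp add: eq_fract)
    then show ?thesis using b unfolding local_ring_def Fract_conv_to_fract by blast
  qed
next
  fix x assume "x \<in> local_ring p"
  then obtain f g where fg: "x = Fract f g" "\<not> p dvd g"
    by (auto simp: local_ring_def Fract_conv_to_fract)
  then have g: "g \<noteq> 0" by auto
  show "x \<in> valuation_ring (adic_valuation p)"
  proof (cases "f = 0")
    case True
    then show ?thesis using fg by (simp add: valuation_ring_def fract_collapse)
  next
    case False
    then show ?thesis
      using adic_valuation_Fract[OF False g] adic_order_eq[OF fg(2), of 0] fg(1)
      by (simp add: valuation_ring_def)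
  qed
qed

lemma to_fract_in_local_ring: "to_fract f \<in> local_ring p"
  using not_dvd_one unfolding local_ring_def by (intro CollectI exI[of _ f] exI[of _ 1]) simp

lemma subring_local_ring: "subring (local_ring p) ring_of_type_algebra"
proof (rule subring_of_typeI)
  show "1 \<in> local_ring p" using to_fract_in_local_ring[of 1] by simp
next
  fix x assume "x \<in> local_ring p"
  then obtain f g where x: "x = to_fract f / to_fract g" "\<not> p dvd g" by (auto simp: local_ring_def)
  then have "- x = to_fract (- f) / to_fract g" by simp
  with x show "- x \<in> local_ring p" unfolding local_ring_def by blast
next
  fix x y assume "x \<in> local_ring p" "y \<in> local_ring p"
  then obtain f g f' g' where x: "x = to_fract f / to_fract g" "\<not> p dvd g"
    and y: "y = to_fract f' / to_fract g'" "\<not> p dvd g'" by (auto simp: local_ring_def)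
  have gg: "\<not> p dvd g * g'" using x y prime by (simp add: prime_elem_dvd_mult_iff)
  have "x * y = to_fract (f * f') / to_fract (g * g')" using x y by simp
  with gg show "x * y \<in> local_ring p" unfolding local_ring_def by blast
  have "g \<noteq> 0" "g' \<noteq> 0" using x y by auto
  then have "x + y = to_fract (f * g' + f' * g) / to_fract (g * g')"
    using x y by (simp add: add_frac_eq)
  with gg show "x + y \<in> local_ring p" unfolding local_ring_def by blast
qed

lemma local_max_subset: "local_max p \<subseteq> local_ring p"
  by (auto simp: local_max_def local_ring_def)

text \<open>Divisibility of the numerator by \<open>p\<close> does not depend on the representation, as long as the
  denominator is prime to \<open>p\<close>.\<close>

lemma fraction_in_local_max_iff:
  assumes "\<not> p dvd g"
  shows "to_fract f / to_fract g \<in> local_max p \<longleftrightarrow> p dvd f"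
proof
  assume "to_fract f / to_fract g \<in> local_max p"
  then obtain f' g' where h: "to_fract f / to_fract g = to_fract f' / to_fract g'"
    "p dvd f'" "\<not> p dvd g'" by (auto simp: local_max_def)
  have "g \<noteq> 0" "g' \<noteq> 0" using h assms by auto
  then have "to_fract (f * g') = to_fract (f' * g)" using h by (simp add: frac_eq_eq)
  then have "f * g' = f' * g" by (simp only: to_fract_eq_iff)
  then have "p dvd f * g'" using h by simp
  then show "p dvd f" using h prime by (simp add: prime_elem_dvd_mult_iff)
qed (use assms in \<open>auto simp: local_max_def\<close>)

lemma to_fract_in_local_max_iff: "to_fract f \<in> local_max p \<longleftrightarrow> p dvd f"
  using fraction_in_local_max_iff[of 1 f] not_dvd_one by simp

lemma inverse_in_local_ring:
  assumes "x \<in> local_ring p" "x \<notin> local_max p"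
  shows "x \<noteq> 0" "1 / x \<in> local_ring p"
proof -
  obtain f g where x: "x = to_fract f / to_fract g" "\<not> p dvd g"
    using assms by (auto simp: local_ring_def)
  then have f: "\<not> p dvd f" using assms fraction_in_local_max_iff by auto
  show "x \<noteq> 0" using f x by auto
  show "1 / x \<in> local_ring p" using f x by (auto simp: local_ring_def)
qed

lemma local_max_mult_iff:
  assumes "x \<in> local_ring p" "y \<in> local_ring p"
  shows "x * y \<in> local_max p \<longleftrightarrow> x \<in> local_max p \<or> y \<in> local_max p"
proof -
  obtain f g f' g' where x: "x = to_fract f / to_fract g" "\<not> p dvd g"
    and y: "y = to_fract f' / to_fract g'" "\<not> p dvd g'" using assms by (auto simp: local_ring_def)
  have gg: "\<not> p dvd g * g'" using x y prime by (simp add: prime_elem_dvd_mult_iff)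
  have "x * y = to_fract (f * f') / to_fract (g * g')" using x y by simp
  then show ?thesis
    using fraction_in_local_max_iff[OF gg, of "f * f'"] fraction_in_local_max_iff x y prime
    by (simp add: prime_elem_dvd_mult_iff)
qed

lemma ideal_local_max: "ideal (local_max p) (subring_of_type (local_ring p))"
  unfolding ideal_subring_of_type_iff[OF subring_local_ring]
proof (intro conjI ballI local_max_subset)
  show "0 \<in> local_max p" using to_fract_in_local_max_iff[of 0] by simp
next
  fix x y assume "x \<in> local_max p" "y \<in> local_max p"
  then obtain f g f' g' where x: "x = to_fract f / to_fract g" "p dvd f" "\<not> p dvd g"
    and y: "y = to_fract f' / to_fract g'" "p dvd f'" "\<not> p dvd g'" by (auto simp: local_max_def)
  have gg: "\<not> p dvd g * g'" using x y prime by (simp add: prime_elem_dvd_mult_iff)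
  have "g \<noteq> 0" "g' \<noteq> 0" using x y by auto
  then have "x + y = to_fract (f * g' + f' * g) / to_fract (g * g')"
    using x y by (simp add: add_frac_eq)
  moreover have "p dvd f * g' + f' * g" using x y by simp
  ultimately show "x + y \<in> local_max p" using gg unfolding local_max_def by blast
next
  fix a x assume "a \<in> local_ring p" "x \<in> local_max p"
  then show "a * x \<in> local_max p" using local_max_mult_iff local_max_subset by blast
qed

lemma one_not_in_local_max: "1 \<notin> local_max p"
  using to_fract_in_local_max_iff[of 1] not_dvd_one by simp

text \<open>All elements outside \<open>local_max p\<close> are units of \<open>local_ring p\<close>, so that this ring is local. This
  identifies the maximal ideal that the center is defined by.\<close>

lemma proper_ideal_subset_local_max:
  assumes J: "ideal J (subring_of_type (local_ring p))" "1 \<notin> J"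
  shows "J \<subseteq> local_max p"
proof (rule subsetI, rule ccontr)
  fix x assume x: "x \<in> J" "x \<notin> local_max p"
  have xl: "x \<in> local_ring p" using J x by (auto simp: ideal_subring_of_type_iff[OF subring_local_ring])
  have "1 / x * x \<in> J"
    using J x inverse_in_local_ring[OF xl x(2)]
    unfolding ideal_subring_of_type_iff[OF subring_local_ring] by blast
  then show False using J inverse_in_local_ring[OF xl x(2)] by simp
qed

lemma center_eq: "center (valuation_ring (adic_valuation p)) A = local_max p \<inter> A"
proof -
  have max: "maximalideal (local_max p) (subring_of_type (local_ring p))"
    using ideal_local_max one_not_in_local_max proper_ideal_subset_local_max
    unfolding maximalideal_subring_of_type_iff[OF subring_local_ring] by blast
  have "(THE M. maximalideal M (subring_of_type (local_ring p))) = local_max p"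
  proof (rule the_equality)
    show "maximalideal (local_max p) (subring_of_type (local_ring p))" by (fact max)
  next
    fix M assume "maximalideal M (subring_of_type (local_ring p))"
    then show "M = local_max p"
      using proper_ideal_subset_local_max ideal_local_max one_not_in_local_max
      unfolding maximalideal_subring_of_type_iff[OF subring_local_ring] by metis
  qed
  then show ?thesis by (simp add: center_def valuation_ring_eq)
qed

end

section \<open>Subrings between a domain and the valuation ring of a prime element\<close>

locale intermediate_ring = finite_order_prime p for p :: "'a::idom" +
  fixes A :: "'a fract set"
  assumes subring: "subring A ring_of_type_algebra"
    and domain_subset: "range to_fract \<subseteq> A"
    and subset_local_ring: "A \<subseteq> local_ring p"
begin

lemma primeideal_center: "primeideal (local_max p \<inter> A) (subring_of_type A)"
  unfolding primeideal_subring_of_type_iff[OF subring] ideal_subring_of_type_iff[OF subring]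
proof (intro conjI ballI impI)
  have M: "0 \<in> local_max p" "\<And>x y. x \<in> local_max p \<Longrightarrow> y \<in> local_max p \<Longrightarrow> x + y \<in> local_max p"
    using ideal_local_max unfolding ideal_subring_of_type_iff[OF subring_local_ring] by blast+
  note A = subring_of_typeD[OF subring]
  show "0 \<in> local_max p \<inter> A" using M A(1) by simp
  show "1 \<notin> local_max p \<inter> A" using one_not_in_local_max by simp
  show "x + y \<in> local_max p \<inter> A" if "x \<in> local_max p \<inter> A" "y \<in> local_max p \<inter> A" for x y
    using that M A(5) by simp
  have mult_iff: "a * x \<in> local_max p \<longleftrightarrow> a \<in> local_max p \<or> x \<in> local_max p" if "a \<in> A" "x \<in> A" for a x
    using that subset_local_ring by (intro local_max_mult_iff) auto
  show "a * x \<in> local_max p \<inter> A" if "a \<in> A" "x \<in> local_max p \<inter> A" for a x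
    using that A(4) mult_iff by simp
  show "a \<in> local_max p \<inter> A \<or> b \<in> local_max p \<inter> A"
    if "a \<in> A" "b \<in> A" "a * b \<in> local_max p \<inter> A" for a b
    using that mult_iff by simp
qed simp

text \<open>The denominators of \<open>local_ring p\<close> belong to \<open>A\<close> and avoid the center, because \<open>A\<close> contains the
  whole domain; conversely, elements of \<open>A\<close> outside the center are units of \<open>local_ring p\<close>.\<close>

lemma localization_center: "localization A (local_max p \<inter> A) = local_ring p"
proof (intro equalityI subsetI)
  fix x assume "x \<in> localization A (local_max p \<inter> A)"
  then obtain a s where x: "x = a / s" "a \<in> A" "s \<in> A" "s \<notin> local_max p"
    by (auto simp: localization_def)
  have "a \<in> local_ring p" "1 / s \<in> local_ring p"
    using x subset_local_ring inverse_in_local_ring by blast+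
  then have "a * (1 / s) \<in> local_ring p" by (rule subring_of_typeD(4)[OF subring_local_ring])
  with x show "x \<in> local_ring p" by simp
next
  fix x assume "x \<in> local_ring p"
  then obtain f g where x: "x = to_fract f / to_fract g" "\<not> p dvd g"
    by (auto simp: local_ring_def)
  then show "x \<in> localization A (local_max p \<inter> A)"
    using domain_subset to_fract_in_local_max_iff unfolding localization_def by blast
qed

text \<open>In the discrete valuation ring \<open>local_ring p\<close>, every nonzero element is a power of \<open>p\<close> times a
  unit. The unit need not be invertible in \<open>A\<close>, but its numerator and denominator are elements of \<open>A\<close>
  outside the center, and multiplying by them or cancelling them does not affect membership in a
  prime inside the center.\<close>

lemma nonzero_prime_below_center:
  assumes Q: "primeideal Q (subring_of_type A)" "Q \<subseteq> local_max p \<inter> A"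
    and x: "x \<in> Q" "x \<noteq> 0"
  shows "Q = local_max p \<inter> A"
proof -
  have Q_mult: "a * y \<in> Q" if "a \<in> A" "y \<in> Q" for a y
    using Q(1) that unfolding primeideal_subring_of_type_iff[OF subring]
      ideal_subring_of_type_iff[OF subring] by blast
  have Q_prime: "a \<in> Q \<or> b \<in> Q" if "a * b \<in> Q" "a \<in> A" "b \<in> A" for a b
    using Q(1) that unfolding primeideal_subring_of_type_iff[OF subring] by blast
  have not_Q: "to_fract f \<notin> Q" if "\<not> p dvd f" for f
    using Q(2) that to_fract_in_local_max_iff by blast
  have D: "to_fract f \<in> A" for f using domain_subset by blast
  have pow: "to_fract p \<in> Q" if "to_fract (p ^ k) \<in> Q" for k
    using that
  proof (induction k)
    case 0
    then show ?case using Q(1) by (simp add: primeideal_subring_of_type_iff[OF subring])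
  next
    case (Suc k)
    then show ?case using Q_prime[of "to_fract p" "to_fract (p ^ k)"] D by auto
  qed
  \<comment> \<open>Clearing the denominator of \<open>x\<close> and cancelling its cofactor leaves a power of \<open>p\<close> in \<open>Q\<close>.\<close>
  obtain f g where fg: "x = to_fract f / to_fract g" "\<not> p dvd g"
    using x Q(2) by (auto simp: local_max_def)
  then have g: "g \<noteq> 0" and f: "f \<noteq> 0" using x by auto
  obtain k a where a: "f = p ^ k * a" "\<not> p dvd a" using prime_factorization[OF f] .
  have "to_fract g * x \<in> Q" using Q_mult D x by blast
  then have "to_fract (p ^ k) * to_fract a \<in> Q" using fg g a by simp
  then have pQ: "to_fract p \<in> Q" using Q_prime D not_Q[OF a(2)] pow by blast
  \<comment> \<open>Up to its denominator, which is outside \<open>Q\<close>, an element of the center is a multiple of \<open>p\<close>.\<close>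
  have "y \<in> Q" if y: "y \<in> local_max p \<inter> A" for y
  proof -
    obtain f' g' where h: "y = to_fract f' / to_fract g'" "p dvd f'" "\<not> p dvd g'"
      using y by (auto simp: local_max_def)
    then have g': "g' \<noteq> 0" by auto
    from h(2) obtain c where "f' = p * c" ..
    then have "to_fract g' * y = to_fract c * to_fract p" using h g' by simp
    then have "to_fract g' * y \<in> Q" using Q_mult[OF D pQ] by simp
    then show ?thesis using Q_prime D y not_Q[OF h(3)] by blast
  qed
  with Q(2) show ?thesis by blast
qed

text \<open>The chain from the zero ideal to the center has length one. In a longer chain, the second
  prime \<open>c 1\<close> would be nonzero and properly contained in the center.\<close>

lemma prime_height_center: "prime_height (subring_of_type A) (local_max p \<inter> A) = 1"
proof -
  let ?P = "local_max p \<inter> A"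
  let ?S = "{enat k |k. \<exists>c. (\<forall>j\<le>k. primeideal (c j) (subring_of_type A)) \<and>
    (\<forall>j<k. c j \<subset> c (Suc j)) \<and> c k = ?P}"
  have zero_in: "0 \<in> Q" if "primeideal Q (subring_of_type A)" for Q
    using that by (simp add: primeideal_subring_of_type_iff[OF subring] ideal_subring_of_type_iff[OF subring])
  have zero: "primeideal {0} (subring_of_type A)"
    using subring_of_typeD[OF subring]
    by (simp add: primeideal_subring_of_type_iff[OF subring] ideal_subring_of_type_iff[OF subring])
  have pP: "to_fract p \<in> ?P" "to_fract p \<noteq> 0"
    using to_fract_in_local_max_iff[of p] domain_subset p_nonzero by auto
  have "{0} \<subset> ?P" using zero_in[OF primeideal_center] pP by blast
  then have "enat 1 \<in> ?S"
    using zero primeideal_center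
    by (intro CollectI exI[of _ 1] exI[of _ "\<lambda>j. if j = 0 then {0} else ?P"] conjI) auto
  moreover have "z \<le> enat 1" if "z \<in> ?S" for z
  proof -
    from that obtain k c where c: "z = enat k" "\<And>j. j \<le> k \<Longrightarrow> primeideal (c j) (subring_of_type A)"
      "\<And>j. j < k \<Longrightarrow> c j \<subset> c (Suc j)" "c k = ?P" by auto
    have "k \<le> 1"
    proof (rule ccontr)
      assume k: "\<not> k \<le> 1"
      have "1 < j \<Longrightarrow> j \<le> k \<Longrightarrow> c 1 \<subset> c j" for j
      proof (induction j)
        case (Suc j)
        then show ?case using c(3)[of j] by (cases "j = 1") auto
      qed simp
      from this[of k] have "c 1 \<subset> ?P" using k c(4) by simp
      moreover obtain x where "x \<in> c 1" "x \<noteq> 0"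
        using c(3)[of 0] zero_in[OF c(2)[of 0]] k by auto
      ultimately show False
        using nonzero_prime_below_center[OF c(2)[of 1]] k by auto
    qed
    with c(1) show ?thesis by simp
  qed
  ultimately have "Sup ?S = enat 1" by (meson Sup_eqI)
  then show ?thesis by (simp add: prime_height_def one_enat_def)
qed

end

section \<open>The variables as prime elements\<close>

lemma sum_monomials:
  fixes f :: "('n::{finite,linorder}, 'k::field) mpoly"
  shows "f = (\<Sum>m\<in>Poly_Mapping.keys f. Poly_Mapping.single m (Poly_Mapping.lookup f m))"
proof (rule poly_mapping_eqI)
  fix m
  have "Poly_Mapping.lookup (\<Sum>m\<in>Poly_Mapping.keys f. Poly_Mapping.single m (Poly_Mapping.lookup f m)) m =
      (\<Sum>m'\<in>Poly_Mapping.keys f. if m' = m then Poly_Mapping.lookup f m' else 0)"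
    by (simp add: lookup_sum lookup_single when_def)
  also have "\<dots> = Poly_Mapping.lookup f m" by (simp add: in_keys_iff)
  finally show "Poly_Mapping.lookup f m = Poly_Mapping.lookup (\<Sum>m\<in>Poly_Mapping.keys f. Poly_Mapping.single m (Poly_Mapping.lookup f m)) m" ..
qed

lemma var_poly_power:
  "var_poly i ^ k = (Poly_Mapping.single (Poly_Mapping.single i k) 1 :: ('n::{finite,linorder}, 'k::field) mpoly)"
  by (induction k) (simp_all add: var_poly_def mult_single single_add[symmetric])

lemma var_poly_power_dvd_exponent:
  fixes f :: "('n::{finite,linorder}, 'k::field) mpoly"
  assumes "var_poly i ^ k dvd f" "m \<in> Poly_Mapping.keys f"
  shows "k \<le> Poly_Mapping.lookup m i"
proof -
  obtain g where "f = var_poly i ^ k * g" using assms(1) ..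
  then have "f = Poly_Mapping.single (Poly_Mapping.single i k) 1 * g"
    by (simp add: var_poly_power)
  then obtain b where "m = Poly_Mapping.single i k + b"
    using assms(2) keys_mult[of "Poly_Mapping.single (Poly_Mapping.single i k) 1" g] by auto
  then show ?thesis by (simp add: lookup_add)
qed

lemma var_poly_dvd_iff:
  fixes f :: "('n::{finite,linorder}, 'k::field) mpoly"
  shows "var_poly i dvd f \<longleftrightarrow> (\<forall>m\<in>Poly_Mapping.keys f. 0 < Poly_Mapping.lookup m i)"
proof
  assume "var_poly i dvd f"
  then show "\<forall>m\<in>Poly_Mapping.keys f. 0 < Poly_Mapping.lookup m i"
    using var_poly_power_dvd_exponent[of i 1 f] by fastforce
next
  assume pos: "\<forall>m\<in>Poly_Mapping.keys f. 0 < Poly_Mapping.lookup m i"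
  have "var_poly i dvd Poly_Mapping.single m (Poly_Mapping.lookup f m)" if m: "m \<in> Poly_Mapping.keys f" for m
  proof -
    have "m = Poly_Mapping.single i 1 + (m - Poly_Mapping.single i 1)"
      by (rule poly_mapping_eqI) (use pos m in \<open>auto simp: lookup_add lookup_minus lookup_single when_def\<close>)
    then have "Poly_Mapping.single m (Poly_Mapping.lookup f m) =
        var_poly i * Poly_Mapping.single (m - Poly_Mapping.single i 1) (Poly_Mapping.lookup f m)"
      by (simp add: var_poly_def mult_single)
    then show ?thesis by simp
  qed
  then have "var_poly i dvd (\<Sum>m\<in>Poly_Mapping.keys f. Poly_Mapping.single m (Poly_Mapping.lookup f m))"
    by (rule dvd_sum)
  then show "var_poly i dvd f" using sum_monomials[of f] by simp
qed

text \<open>The witness consists of the terms of \<open>f\<close> free of the variable, i.e. it represents the residue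
  class of \<open>f\<close> modulo the variable.\<close>

lemma split_off_variable:
  fixes f :: "('n::{finite,linorder}, 'k::field) mpoly"
  obtains f0 where "var_poly i dvd f - f0" "\<And>m. m \<in> Poly_Mapping.keys f0 \<Longrightarrow> Poly_Mapping.lookup m i = 0"
proof
  let ?f0 = "Poly_Mapping.mapp (\<lambda>m c. if Poly_Mapping.lookup m i = 0 then c else 0) f"
  show "Poly_Mapping.lookup m i = 0" if "m \<in> Poly_Mapping.keys ?f0" for m
    using that by (auto simp: in_keys_iff lookup_mapp when_def split: if_splits)
  show "var_poly i dvd f - ?f0"
    unfolding var_poly_dvd_iff
    by (auto simp: in_keys_iff lookup_minus lookup_mapp when_def split: if_splits)
qed

text \<open>Modulo the variable, a product is represented by the product of the parts free of the variable.
  The latter product is again free of the variable, so that it is divisible by the variable only if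
  it vanishes; then one factor vanishes, as polynomials form a domain.\<close>

lemma prime_elem_var_poly:
  "prime_elem (var_poly i :: ('n::{finite,linorder}, 'k::field) mpoly)"
  unfolding prime_elem_def
proof (intro conjI allI impI)
  show "var_poly i \<noteq> (0 :: ('n, 'k) mpoly)"
    by (metis keys_single keys_zero var_poly_def insert_not_empty zero_neq_one)
  show "\<not> var_poly i dvd (1 :: ('n, 'k) mpoly)"
    by (simp add: var_poly_dvd_iff)
  fix f g :: "('n, 'k) mpoly"
  assume fg: "var_poly i dvd f * g"
  obtain f0 where f0: "var_poly i dvd f - f0" "\<And>m. m \<in> Poly_Mapping.keys f0 \<Longrightarrow> Poly_Mapping.lookup m i = 0"
    by (rule split_off_variable[of i f]) blast
  obtain g0 where g0: "var_poly i dvd g - g0" "\<And>m. m \<in> Poly_Mapping.keys g0 \<Longrightarrow> Poly_Mapping.lookup m i = 0"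
    by (rule split_off_variable[of i g]) blast
  have "f0 * g0 = f * g - ((f - f0) * g + f0 * (g - g0))" by (simp add: algebra_simps)
  then have "var_poly i dvd f0 * g0" using fg f0 g0 by (metis dvd_diff dvd_add dvd_mult dvd_mult2)
  moreover have "Poly_Mapping.lookup m i = 0" if "m \<in> Poly_Mapping.keys (f0 * g0)" for m
    using that keys_mult[of f0 g0] f0(2) g0(2) by (auto simp: lookup_add)
  ultimately have "Poly_Mapping.keys (f0 * g0) = {}" unfolding var_poly_dvd_iff by fastforce
  then have "f0 = 0 \<or> g0 = 0" by (metis in_keys_iff empty_iff lookup_zero mult_eq_0_iff poly_mapping_eqI)
  then show "var_poly i dvd f \<or> var_poly i dvd g" using f0(1) g0(1) by auto
qed

text \<open>The order of the variable in \<open>f\<close> is bounded by its exponent in any monomial of \<open>f\<close>.\<close>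

interpretation var: finite_order_prime "var_poly i :: ('n::{finite,linorder}, 'k::field) mpoly" for i
proof
  show "prime_elem (var_poly i :: ('n, 'k) mpoly)" by (rule prime_elem_var_poly)
  fix f :: "('n, 'k) mpoly"
  assume "f \<noteq> 0"
  then obtain m where "m \<in> Poly_Mapping.keys f" by (metis in_keys_iff lookup_zero poly_mapping_eqI)
  then have "\<not> var_poly i ^ Suc (Poly_Mapping.lookup m i) dvd f"
    using var_poly_power_dvd_exponent[of i "Suc (Poly_Mapping.lookup m i)" f m] by auto
  then show "\<exists>k. \<not> var_poly i ^ k dvd f" ..
qed

lemma locD_eq: "locD i = local_ring (var_poly i :: ('n::{finite,linorder}, 'k::field) mpoly)"
proof -
  have "PIdl\<^bsub>subring_of_type polyD\<^esub> (ratX i :: ('n, 'k) mpoly fract) = {to_fract f |f. var_poly i dvd f}"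
    unfolding cgenideal_def polyD_def ratX_def ring_of_type_algebra_def
    by (force simp: dvd_def mult.commute)
  then show ?thesis
    unfolding locD_def localization_def local_ring_def polyD_def by force
qed

section \<open>Reciprocals of polynomials in the inverse variables\<close>

locale variable_inversion =
  fixes \<sigma> :: "('n::{finite,linorder}, 'k::field) mpoly fract \<Rightarrow> ('n, 'k) mpoly fract"
  assumes aut: "\<sigma> \<in> ring_iso ring_of_type_algebra ring_of_type_algebra"
    and fixes_K: "\<And>c. \<sigma> (ratC c) = ratC c"
    and inverts: "\<And>i. \<sigma> (ratX i) = 1 / ratX i"
begin

lemma hom_one: "\<sigma> 1 = 1" and hom_add: "\<sigma> (x + y) = \<sigma> x + \<sigma> y"
  and hom_mult: "\<sigma> (x * y) = \<sigma> x * \<sigma> y"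
  using aut unfolding ring_iso_def ring_hom_def by (auto simp: ring_of_type_algebra_def)

lemma hom_zero: "\<sigma> 0 = 0"
  using hom_add[of 0 0] unfolding add_0_left by (simp only: add_cancel_right_right)

lemma hom_uminus: "\<sigma> (- x) = - \<sigma> x"
  using hom_add[of x "- x"] hom_zero by (simp add: eq_neg_iff_add_eq_0 add.commute)

lemma hom_inverse: "\<sigma> (1 / x) = 1 / \<sigma> x"
proof (cases "x = 0")
  case False
  then have "\<sigma> x * \<sigma> (1 / x) = 1" using hom_mult[of x "1 / x"] hom_one by simp
  then show ?thesis by (metis mult_zero_left nonzero_eq_divide_eq mult.commute zero_neq_one)
qed (simp add: hom_zero)

lemma hom_sum: "\<sigma> (sum f S) = (\<Sum>s\<in>S. \<sigma> (f s))"
  by (induction S rule: infinite_finite_induct) (simp_all add: hom_zero hom_add)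

lemma hom_monomial:
  "\<sigma> (to_fract (Poly_Mapping.single m 1)) = 1 / to_fract (Poly_Mapping.single m 1)"
proof (induction m rule: update_induct)
  case const
  then show ?case by (simp add: hom_one)
next
  case (update m i k)
  have pow: "\<sigma> (to_fract (var_poly i ^ k)) = 1 / to_fract (var_poly i ^ k)" for k
    using inverts[of i] by (induction k) (simp_all add: hom_one hom_mult ratX_def)
  have "Poly_Mapping.update i k m = m + Poly_Mapping.single i k"
    using update(1,2)
    by (intro poly_mapping_eqI) (auto simp: lookup_update lookup_add lookup_single when_def in_keys_iff)
  then have "Poly_Mapping.single (Poly_Mapping.update i k m) 1 =
      Poly_Mapping.single m 1 * (var_poly i ^ k :: ('n, 'k) mpoly)"
    by (simp add: var_poly_power mult_single)
  then show ?case using pow[of k] update by (simp add: hom_mult)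
qed

text \<open>Here \<open>g\<close> is the reversed polynomial, obtained from \<open>f\<close> by replacing each exponent vector \<open>m\<close> by
  \<open>N - m\<close>, where \<open>N\<close> is the componentwise maximum of the exponents. The maximum in the component \<open>i\<close> is
  attained at some \<open>m\<^sub>0\<close>, and the monomial \<open>N - m\<^sub>0\<close> of \<open>g\<close> does not involve \<open>X\<^sub>i\<close>.\<close>

lemma hom_polynomial:
  fixes f :: "('n, 'k) mpoly"
  assumes "f \<noteq> 0"
  obtains N g where "\<sigma> (to_fract f) = to_fract g / to_fract (Poly_Mapping.single N 1)"
    "\<And>i. \<not> var_poly i dvd g"
proof
  define N where "N = Abs_poly_mapping (\<lambda>j. Max ((\<lambda>m. Poly_Mapping.lookup m j) ` Poly_Mapping.keys f))"
  define g where "g = (\<Sum>m\<in>Poly_Mapping.keys f. Poly_Mapping.single (N - m) (Poly_Mapping.lookup f m))"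
  have N: "Poly_Mapping.lookup N j = Max ((\<lambda>m. Poly_Mapping.lookup m j) ` Poly_Mapping.keys f)" for j
    unfolding N_def by (subst lookup_Abs_poly_mapping) auto
  have le: "Poly_Mapping.lookup m j \<le> Poly_Mapping.lookup N j" if "m \<in> Poly_Mapping.keys f" for m j
    unfolding N using that by (intro Max_ge) auto
  have N_diff: "m + (N - m) = N" if "m \<in> Poly_Mapping.keys f" for m
    using le[OF that] by (intro poly_mapping_eqI) (simp add: lookup_add lookup_minus)
  have monomial: "Poly_Mapping.single N 1 \<noteq> (0 :: ('n, 'k) mpoly)" for N
    by (metis lookup_single_eq lookup_zero zero_neq_one)
  have "\<sigma> (to_fract (Poly_Mapping.single m c)) =
      to_fract (Poly_Mapping.single (N - m) c) / to_fract (Poly_Mapping.single N 1)"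
    if m: "m \<in> Poly_Mapping.keys f" for m c
  proof -
    have "Poly_Mapping.single m c = const_poly c * Poly_Mapping.single m 1"
      by (simp add: const_poly_def mult_single)
    then have 1: "\<sigma> (to_fract (Poly_Mapping.single m c)) =
        to_fract (const_poly c) / to_fract (Poly_Mapping.single m 1)"
      using fixes_K[of c] by (simp add: hom_mult hom_monomial ratC_def)
    have "const_poly c * Poly_Mapping.single N 1 =
        Poly_Mapping.single (N - m) c * Poly_Mapping.single m (1 :: 'k)"
      using N_diff[OF m] by (simp add: const_poly_def mult_single add.commute)
    then have "to_fract (const_poly c) * to_fract (Poly_Mapping.single N 1) =
        to_fract (Poly_Mapping.single (N - m) c) * to_fract (Poly_Mapping.single m (1 :: 'k))"
      by (metis to_fract_mult)
    with 1 show ?thesis using monomial by (simp add: frac_eq_eq)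
  qed
  then have "(\<Sum>m\<in>Poly_Mapping.keys f. \<sigma> (to_fract (Poly_Mapping.single m (Poly_Mapping.lookup f m)))) =
      to_fract g / to_fract (Poly_Mapping.single N 1)"
    by (simp add: g_def sum_divide_distrib)
  then show "\<sigma> (to_fract f) = to_fract g / to_fract (Poly_Mapping.single N 1)"
    using arg_cong[OF sum_monomials[of f], of "\<lambda>f. \<sigma> (to_fract f)"]
    by (simp only: to_fract_sum hom_sum)
  fix i
  have "Poly_Mapping.keys f \<noteq> {}" using assms by (metis in_keys_iff empty_iff lookup_zero poly_mapping_eqI)
  then have "Poly_Mapping.lookup N i \<in> (\<lambda>m. Poly_Mapping.lookup m i) ` Poly_Mapping.keys f" unfolding N by (intro Max_in) auto
  then obtain m0 where m0: "m0 \<in> Poly_Mapping.keys f" "Poly_Mapping.lookup m0 i = Poly_Mapping.lookup N i" by auto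
  \<comment> \<open>Reversal is injective on the exponents of \<open>f\<close>, so that no terms of \<open>g\<close> cancel.\<close>
  have inj: "N - m = N - m0 \<longleftrightarrow> m = m0" if "m \<in> Poly_Mapping.keys f" for m
    using N_diff[OF that] N_diff[OF m0(1)] by (metis add_right_cancel)
  have "Poly_Mapping.lookup g (N - m0) = (\<Sum>m\<in>Poly_Mapping.keys f. if m = m0 then Poly_Mapping.lookup f m else 0)"
    unfolding g_def lookup_sum by (intro sum.cong) (auto simp: lookup_single when_def inj)
  also have "\<dots> = Poly_Mapping.lookup f m0" using m0 by simp
  finally have "N - m0 \<in> Poly_Mapping.keys g" using m0 by (simp add: in_keys_iff)
  moreover have "Poly_Mapping.lookup (N - m0) i = 0" using m0 by (simp add: lookup_minus)
  ultimately show "\<not> var_poly i dvd g" unfolding var_poly_dvd_iff by force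
qed

text \<open>It is enough to treat the generators \<open>1 / f\<close>, whose images \<open>X\<^sup>N / g\<close> have a denominator prime to
  the variable.\<close>

lemma image_reciprocal_complement_subset: "\<sigma> ` reciprocal_complement \<subseteq> local_ring (var_poly i)"
proof (rule image_subsetI)
  interpret R: ring "ring_of_type_algebra :: ('n, 'k) mpoly fract ring" by rule
  have neg: "\<ominus>\<^bsub>ring_of_type_algebra\<^esub> x = - x" for x :: "('n, 'k) mpoly fract"
    by (rule R.minus_equality) (auto simp: ring_of_type_algebra_def)
  fix x :: "('n, 'k) mpoly fract" assume "x \<in> reciprocal_complement"
  then show "\<sigma> x \<in> local_ring (var_poly i)"
    unfolding reciprocal_complement_def
  proof (induction x rule: generate_ring.induct)
    case one
    then show ?case
      using subring_of_typeD(2)[OF var.subring_local_ring] by (simp add: ring_of_type_algebra_def hom_one)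
  next
    case (incl h)
    then obtain f where f: "h = 1 / to_fract f" "f \<noteq> 0" by auto
    obtain N g where g: "\<sigma> (to_fract f) = to_fract g / to_fract (Poly_Mapping.single N 1)"
      "\<And>i. \<not> var_poly i dvd g" by (rule hom_polynomial[OF f(2)]) blast
    have "\<sigma> h = to_fract (Poly_Mapping.single N 1) / to_fract g"
      using f g by (simp add: hom_inverse)
    with g show ?case unfolding local_ring_def by blast
  next
    case (a_inv h)
    then show ?case using subring_of_typeD(3)[OF var.subring_local_ring] by (simp add: neg hom_uminus)
  next
    case (eng_add x y)
    then show ?case using subring_of_typeD(5)[OF var.subring_local_ring]
      by (simp add: ring_of_type_algebra_def hom_add)
  next
    case (eng_mult x y)
    then show ?case using subring_of_typeD(4)[OF var.subring_local_ring]
      by (simp add: ring_of_type_algebra_def hom_mult)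
  qed
qed

lemma subring_image: "subring (\<sigma> ` reciprocal_complement) ring_of_type_algebra"
proof -
  interpret R: ring "ring_of_type_algebra :: ('n, 'k) mpoly fract ring" by rule
  have "subring (reciprocal_complement :: ('n, 'k) mpoly fract set) ring_of_type_algebra"
    unfolding reciprocal_complement_def
    by (rule R.generate_ring_is_subring) (simp add: ring_of_type_algebra_def)
  note D = subring_of_typeD[OF this]
  show ?thesis
  proof (rule subring_of_typeI)
    show "1 \<in> \<sigma> ` reciprocal_complement"
      by (rule image_eqI[OF _ D(2)]) (simp add: hom_one)
  next
    fix x assume "x \<in> \<sigma> ` reciprocal_complement"
    then obtain a where a: "x = \<sigma> a" "a \<in> reciprocal_complement" by blast
    show "- x \<in> \<sigma> ` reciprocal_complement"
      by (rule image_eqI[OF _ D(3)[OF a(2)]]) (simp add: a hom_uminus)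
  next
    fix x y assume "x \<in> \<sigma> ` reciprocal_complement" "y \<in> \<sigma> ` reciprocal_complement"
    then obtain a b where ab: "x = \<sigma> a" "a \<in> reciprocal_complement"
      "y = \<sigma> b" "b \<in> reciprocal_complement" by blast
    show "x * y \<in> \<sigma> ` reciprocal_complement"
      by (rule image_eqI[OF _ D(4)[OF ab(2,4)]]) (simp add: ab hom_mult)
    show "x + y \<in> \<sigma> ` reciprocal_complement"
      by (rule image_eqI[OF _ D(5)[OF ab(2,4)]]) (simp add: ab hom_add)
  qed
qed

text \<open>Constants and monomials are images of reciprocals of polynomials, and they generate the
  polynomial ring.\<close>

lemma polynomial_in_image: "to_fract f \<in> \<sigma> ` reciprocal_complement"
proof -
  note A = subring_of_typeD[OF subring_image]
  have reciprocal: "1 / to_fract f \<in> reciprocal_complement" if "f \<noteq> 0" for f :: "('n, 'k) mpoly"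
    unfolding reciprocal_complement_def using that by (blast intro: generate_ring.incl)
  have monomial: "Poly_Mapping.single m c \<noteq> 0" if "c \<noteq> 0" for m and c :: 'k
    using that by (metis lookup_single_eq lookup_zero)
  have const: "to_fract (const_poly c) \<in> \<sigma> ` reciprocal_complement" if "c \<noteq> 0" for c
  proof -
    have "const_poly c * const_poly (1 / c) = (1 :: ('n, 'k) mpoly)"
      using that by (simp add: const_poly_def mult_single)
    then have "to_fract (const_poly c) * to_fract (const_poly (1 / c)) = (1 :: ('n, 'k) mpoly fract)"
      by (metis to_fract_mult to_fract_1)
    then have "to_fract (const_poly c) = 1 / (ratC (1 / c) :: ('n, 'k) mpoly fract)"
      by (metis ratC_def mult_zero_right nonzero_eq_divide_eq zero_neq_one)
    also have "\<dots> = \<sigma> (1 / to_fract (const_poly (1 / c)))"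
      by (metis hom_inverse fixes_K ratC_def)
    finally have "to_fract (const_poly c) = \<sigma> (1 / to_fract (const_poly (1 / c)))" .
    moreover have "const_poly (1 / c) \<noteq> (0 :: ('n, 'k) mpoly)"
      using that monomial[of "1 / c" 0] by (simp add: const_poly_def)
    ultimately show ?thesis using reciprocal by blast
  qed
  have mono: "to_fract (Poly_Mapping.single m 1) \<in> \<sigma> ` reciprocal_complement" for m
  proof -
    have "to_fract (Poly_Mapping.single m 1) = \<sigma> (1 / to_fract (Poly_Mapping.single m 1))"
      by (simp add: hom_inverse hom_monomial)
    then show ?thesis using reciprocal[OF monomial] by (metis imageI zero_neq_one)
  qed
  have mult_monomial: "to_fract (Poly_Mapping.single m c) \<in> \<sigma> ` reciprocal_complement" if "c \<noteq> 0" for m c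
  proof -
    have "Poly_Mapping.single m c = const_poly c * Poly_Mapping.single m 1"
      by (simp add: const_poly_def mult_single)
    then show ?thesis using A(4)[OF const[OF that] mono[of m]] by simp
  qed
  have "(\<Sum>m\<in>S. to_fract (Poly_Mapping.single m (Poly_Mapping.lookup f m))) \<in> \<sigma> ` reciprocal_complement"
    if "finite S" "S \<subseteq> Poly_Mapping.keys f" for S
    using that by (induction S rule: finite_induct) (auto intro!: A(1,5) mult_monomial simp: in_keys_iff)
  from this[of "Poly_Mapping.keys f"] show ?thesis
    using arg_cong[OF sum_monomials[of f], of to_fract] by (simp only: to_fract_sum finite_keys subset_refl)
qed

lemma intermediate_ring: "intermediate_ring (var_poly i) (\<sigma> ` reciprocal_complement)"
  using subring_image polynomial_in_image image_reciprocal_complement_subset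
  by (intro intermediate_ring.intro intermediate_ring_axioms.intro var.finite_order_prime_axioms) blast+

end

section \<open>The primes centered at the variables\<close>

theorem lemma3p6:
  fixes \<sigma> :: "('n::{finite,linorder}, 'k::field) mpoly fract \<Rightarrow> ('n, 'k) mpoly fract"
    and Rstar :: "('n, 'k) mpoly fract set"
    and \<pp> :: "'n \<Rightarrow> ('n, 'k) mpoly fract set"
  assumes aut: "\<sigma> \<in> ring_iso ring_of_type_algebra ring_of_type_algebra"
    and fixes_K: "\<And>c. \<sigma> (ratC c) = ratC c"
    and inverts: "\<And>i. \<sigma> (ratX i) = 1 / ratX i"
    and Rstar: "Rstar = \<sigma> ` reciprocal_complement"
    and \<pp>: "\<And>i. \<pp> i = center (valuation_ring (adic_valuation (var_poly i))) Rstar"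
  shows "(\<forall>i. Rstar \<subseteq> locD i) \<and>
    inj \<pp> \<and>
    (\<forall>i. primeideal (\<pp> i) (subring_of_type Rstar) \<and>
      prime_height (subring_of_type Rstar) (\<pp> i) = 1 \<and>
      localization Rstar (\<pp> i) = locD i)"
proof -
  interpret variable_inversion \<sigma> by unfold_locales (fact aut fixes_K inverts)+
  have center: "\<pp> i = local_max (var_poly i) \<inter> Rstar" for i
    by (simp add: \<pp> var.center_eq)
  have ring: "intermediate_ring (var_poly i) Rstar" for i
    using intermediate_ring Rstar by simp
  have "inj \<pp>"
  proof (rule injI)
    fix i j assume eq: "\<pp> i = \<pp> j"
    have "ratX i \<in> \<pp> i"
      using polynomial_in_image[of "var_poly i"]
      by (simp add: center Rstar ratX_def var.to_fract_in_local_max_iff)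
    then have "var_poly j dvd (var_poly i :: ('n, 'k) mpoly)"
      unfolding eq by (simp add: center ratX_def var.to_fract_in_local_max_iff)
    then have "0 < Poly_Mapping.lookup (Poly_Mapping.single i (1 :: nat)) j"
      unfolding var_poly_dvd_iff by (simp add: var_poly_def)
    then show "i = j" by (simp add: lookup_single when_def split: if_splits)
  qed
  moreover have "Rstar \<subseteq> locD i" for i
    using intermediate_ring.subset_local_ring[OF ring] by (simp add: locD_eq)
  ultimately show ?thesis
    using intermediate_ring.primeideal_center[OF ring] intermediate_ring.prime_height_center[OF ring]
      intermediate_ring.localization_center[OF ring]
    by (simp add: center locD_eq)
qed

end
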